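(* Let $(E_k)_{k\ge 1}$ be a sequence of $\mu$-measurable subsets of $X$. Suppose that there exist constants $C,N,\delta,\tau>0$ and $\sigma\in(0,1]$ and a summable function $\Psi\colon\mathbb{N}\to[0,\infty)$ such that, for positive integers $k,l$, \begin{align*} \mu(E_k) &\le \frac{C}{(\log k)^{(2+N)/\delta}} && \text{for all } k>0,\\ \mu(E_k\cap E_{k+l}) &\le \mu(E_k)\mu(E_{k+l}) + C\bigl(e^{-\tau k}+e^{-\tau l}\bigr) && \text{for all } k,l>0,\\ \mu(E_k\cap E_{k+l}) &\le C\mu(E_k)^{1+\delta}(\log k)^{N} + \mu(E_k)\Psi(l) && \text{whenever } l\le(\log k)^2,\\ \mu(E_k\cap E_{k+l}) &\le \mu(E_k)\mu(E_{k+l}) + C\mu(E_{k+l})e^{-\tau k} + Ce^{-\tau l} && \text{whenever } k\le\sigma l. \end{align*} Let $\Phi(n)=\sum_{k=1}^{n}\mu(E_k)$. Then for every $\varepsilon>0$, for $\mu$-almost every $x\in X$, \[ \sum_{k=1}^{n}\mathbf{1}_{E_k}(x)=\Phi(n)+O\bigl(\Phi(n)^{1/2}(\log\Phi(n))^{3/2+\varepsilon}\bigr)\qquad (n\to\infty). \]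
   Context: Standing setting: $(X,T,\mu,d)$ is a metric measure-preserving system, i.e. $(X,d)$ is a metric space, $T\colon X\to X$ is measurable and $\mu$ is a Borel probability measure with $\mu(T^{-1}A)=\mu(A)$ for all $\mu$-measurable $A$; $X$ is a compact Riemannian manifold. $\mathbf{1}_E$ denotes the indicator function of $E$. For $k=1$ the bound $C/(\log k)^{(2+N)/\delta}$ is read as $+\infty$ (no condition). The implied constant in $O(\cdot)$ may depend on $x$ and $\varepsilon$. Convention: if $\Phi(n)$ stays bounded as $n\to\infty$, the conclusion is read as saying that the difference $\sum_{k=1}^n\mathbf{1}_{E_k}(x)-\Phi(n)$ is bounded in $n$ for $\mu$-a.e. $x$. *)

theory Defs
  imports "HOL-Probability.Probability" "HOL-Library.Landau_Symbols"
begin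

text \<open>On an open set, and for a finite-dimensional domain, this is the usual notion of being
  $k$ times continuously differentiable: all iterated directional derivatives up to order $k$
  exist in the Frechet sense and are continuous.\<close>

primrec Ck_on :: "nat \<Rightarrow> ('a::real_normed_vector \<Rightarrow> 'b::real_normed_vector) \<Rightarrow> 'a set \<Rightarrow> bool" where
  "Ck_on 0 f S \<longleftrightarrow> continuous_on S f"
| "Ck_on (Suc k) f S \<longleftrightarrow>
     (\<forall>x\<in>S. f differentiable at x) \<and> (\<forall>v. Ck_on k (\<lambda>x. frechet_derivative f (at x) v) S)"

definition smooth_on :: "('a::real_normed_vector \<Rightarrow> 'b::real_normed_vector) \<Rightarrow> 'a set \<Rightarrow> bool" where
  "smooth_on f S \<longleftrightarrow> (\<forall>k. Ck_on k f S)"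

text \<open>A chart is a pair of a domain and a coordinate map; values of the coordinate map outside
  the domain are irrelevant.\<close>

type_synonym ('a, 'b) chart = "'a set \<times> ('a \<Rightarrow> 'b)"

definition transition :: "('a, 'b) chart \<Rightarrow> ('a, 'b) chart \<Rightarrow> 'b \<Rightarrow> 'b" where
  "transition c c' = snd c' \<circ> inv_into (fst c) (snd c)"

definition smooth_atlas :: "('a::topological_space, 'b::euclidean_space) chart set \<Rightarrow> bool" where
  "smooth_atlas A \<longleftrightarrow>
     (\<Union>(U, \<phi>)\<in>A. U) = UNIV \<and>
     (\<forall>(U, \<phi>)\<in>A. open U \<and> open (\<phi> ` U) \<and> homeomorphism U (\<phi> ` U) \<phi> (inv_into U \<phi>)) \<and>
     (\<forall>c\<in>A. \<forall>c'\<in>A. smooth_on (transition c c') (snd c ` (fst c \<inter> fst c')))"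

text \<open>The tensor is given in coordinates: \<open>g c y u v\<close> is the inner product of the
  tangent vectors with components \<open>u\<close> and \<open>v\<close> in the chart \<open>c\<close>, at the point with
  coordinates \<open>y\<close>. The last clause is invariance under change of chart.\<close>

definition riemannian_tensor ::
  "('a::topological_space, 'b::euclidean_space) chart set \<Rightarrow>
   (('a, 'b) chart \<Rightarrow> 'b \<Rightarrow> 'b \<Rightarrow> 'b \<Rightarrow> real) \<Rightarrow> bool" where
  "riemannian_tensor A g \<longleftrightarrow>
     (\<forall>c\<in>A. \<forall>y\<in>snd c ` fst c.
        bilinear (g c y) \<and> (\<forall>u v. g c y u v = g c y v u) \<and> (\<forall>u. u \<noteq> 0 \<longrightarrow> g c y u u > 0)) \<and>
     (\<forall>c\<in>A. \<forall>u v. smooth_on (\<lambda>y. g c y u v) (snd c ` fst c)) \<and>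
     (\<forall>c\<in>A. \<forall>c'\<in>A. \<forall>p\<in>fst c \<inter> fst c'. \<forall>u v.
        g c (snd c p) u v =
          g c' (snd c' p)
            (frechet_derivative (transition c c') (at (snd c p)) u)
            (frechet_derivative (transition c c') (at (snd c p)) v))"

definition C1_curve ::
  "('a::topological_space, 'b::euclidean_space) chart set \<Rightarrow> (real \<Rightarrow> 'a) \<Rightarrow> bool" where
  "C1_curve A \<gamma> \<longleftrightarrow>
     continuous_on {0..1} \<gamma> \<and>
     (\<forall>(U, \<phi>)\<in>A. \<exists>D. continuous_on {t\<in>{0..1}. \<gamma> t \<in> U} D \<and>
        (\<forall>t\<in>{0..1}. \<gamma> t \<in> U \<longrightarrow> (\<phi> \<circ> \<gamma> has_vector_derivative D t) (at t within {0..1})))"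

text \<open>The choice of chart does not matter, by invariance of \<open>g\<close>.\<close>

definition curve_speed ::
  "('a::topological_space, 'b::euclidean_space) chart set \<Rightarrow>
   (('a, 'b) chart \<Rightarrow> 'b \<Rightarrow> 'b \<Rightarrow> 'b \<Rightarrow> real) \<Rightarrow> (real \<Rightarrow> 'a) \<Rightarrow> real \<Rightarrow> real" where
  "curve_speed A g \<gamma> t =
     (let c = (SOME c. c \<in> A \<and> \<gamma> t \<in> fst c);
          v = vector_derivative (snd c \<circ> \<gamma>) (at t within {0..1})
      in sqrt (g c (snd c (\<gamma> t)) v v))"

text \<open>Curves need not be regular, so every piecewise \<open>C\<^sup>1\<close> curve can be
  reparametrised (stopping at its corners) to a \<open>C\<^sup>1\<close> curve of the same length; hence this
  is the usual Riemannian distance.\<close>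

definition riemannian_dist ::
  "('a::topological_space, 'b::euclidean_space) chart set \<Rightarrow>
   (('a, 'b) chart \<Rightarrow> 'b \<Rightarrow> 'b \<Rightarrow> 'b \<Rightarrow> real) \<Rightarrow> 'a \<Rightarrow> 'a \<Rightarrow> real" where
  "riemannian_dist A g x y =
     Inf {integral {0..1} (curve_speed A g \<gamma>) | \<gamma>. C1_curve A \<gamma> \<and> \<gamma> 0 = x \<and> \<gamma> 1 = y}"

text \<open>The metric of the type \<open>'a\<close> is the Riemannian distance within each component;
  between different components, where the Riemannian distance is infinite, it is only required
  to induce the manifold topology (implicit in the charts being homeomorphisms).
  The class \<open>euclidean_space\<close> has no space of dimension 0, hence the separate clause for
  compact manifolds of dimension 0, which are the finite (discrete) spaces.\<close>

definition compact_riemannian_manifold ::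
  "('a::metric_space, 'b::euclidean_space) chart set \<Rightarrow>
   (('a, 'b) chart \<Rightarrow> 'b \<Rightarrow> 'b \<Rightarrow> 'b \<Rightarrow> real) \<Rightarrow> bool" where
  "compact_riemannian_manifold A g \<longleftrightarrow>
     compact (UNIV :: 'a set) \<and>
     (finite (UNIV :: 'a set) \<or>
      smooth_atlas A \<and> riemannian_tensor A g \<and>
      (\<forall>x y. path_component UNIV x y \<longrightarrow> dist x y = riemannian_dist A g x y))"

text \<open>A set is \<open>\<mu>\<close>-measurable if it belongs to the completion of the Borel
  \<open>\<sigma>\<close>-algebra with respect to \<open>\<mu>\<close>.\<close>

locale metric_mps = prob_space M for M :: "'a::metric_space measure" +
  fixes T :: "'a \<Rightarrow> 'a"
  assumes sets_M: "sets M = sets borel"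
    and T_measurable: "T \<in> borel \<rightarrow>\<^sub>M borel"
    and T_preserving:
      "\<And>A. A \<in> sets (completion M) \<Longrightarrow>
         T -` A \<in> sets (completion M) \<and> measure (completion M) (T -` A) = measure (completion M) A"

end

theory Submission
  imports Defs "HOL-Real_Asymp.Real_Asymp"
begin

text \<open>
  Write \<open>a k = \<mu> (E k)\<close>. The proof is the second moment method on blocks of indices, followed by a
  chaining argument in the manner of Gal and Koksma.

  The first half shows that the counts of two indices are almost uncorrelated: the variance of the
  count over any finite set of indices \<open>k\<close> is at most a constant times the sum of
  \<open>a k + \<rho> k\<close>, with a fixed summable error \<open>\<rho>\<close> (\<open>covariance_sum_bound\<close>). A pair
  \<open>(k, k + d)\<close> falls into one of three ranges.
  For \<open>d \<le> (ln k)\<^sup>2\<close> the events may be strongly dependent, but there are at most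
  \<open>(ln k)\<^sup>2\<close> such \<open>d\<close>. Each costs at most \<open>C a(k)\<^sup>1\<^sup>+\<^sup>\<delta> (ln k)\<^sup>N + a(k) \<Psi>(d)\<close>, and the
  assumed bound on \<open>a k\<close> makes \<open>a(k)\<^sup>\<delta>\<close> small enough to absorb the factor
  \<open>(ln k)\<^sup>2\<^sup>+\<^sup>N\<close>; in total they cost a constant times \<open>a k\<close>.
  For \<open>(ln k)\<^sup>2 < d \<le> k / \<sigma>\<close> decorrelation leaves exponential errors: those in \<open>k\<close> add up
  to a multiple of \<open>k exp (- \<tau> k)\<close>, and those in \<open>d\<close> to a multiple of
  \<open>exp (- \<tau>/2 (ln k)\<^sup>2)\<close>, since \<open>d\<close> exceeds \<open>(ln k)\<^sup>2\<close>. Both are summable in \<open>k\<close>.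
  For \<open>d \<ge> k / \<sigma>\<close> there are too many \<open>d\<close> to afford an error in \<open>k\<close> alone. The
  extra factor \<open>a (k + d)\<close> is what helps there: for a fixed second index \<open>l = k + d\<close>, the errors add
  up over \<open>k\<close> to a constant times \<open>a l\<close>.

  The second half turns such a variance bound into an almost sure one
  (\<open>gal_koksma_strong_law\<close>). Time is measured by \<open>F n\<close>, the sum of \<open>a k + \<rho> k\<close> up
  to \<open>n\<close>, with checkpoints where \<open>F\<close> passes the integers. At each of the \<open>r\<close> dyadic scales
  below \<open>2\<^sup>r\<close> the squared increments between checkpoints have total mean of order \<open>2\<^sup>r\<close>, so
  all scales together have mean of order \<open>r 2\<^sup>r\<close>; summing over \<open>r\<close> shows that almost surely
  they add up to \<open>O(2\<^sup>r r\<^sup>2\<^sup>+\<^sup>2\<^sup>\<epsilon>)\<close>. A checkpoint below \<open>2\<^sup>r\<close> is reached in at most \<open>r\<close> dyadic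
  increments, and Cauchy--Schwarz gives a squared deviation of \<open>O(2\<^sup>r r\<^sup>3\<^sup>+\<^sup>2\<^sup>\<epsilon>)\<close>, which is the claim because
  \<open>2\<^sup>r\<close> is comparable to \<open>F n\<close>. Between checkpoints the count is monotone and its mean moves by
  \<open>O(1)\<close>. Finally \<open>F - \<Phi>\<close> is bounded, so \<open>F\<close> may be replaced by \<open>\<Phi>\<close>.

  If \<open>\<Phi>\<close> is bounded, the first Borel--Cantelli lemma says that almost every point lies in only finitely
  many \<open>E k\<close>, and both terms of the difference stay bounded.
\<close>

section \<open>Dyadic chaining along checkpoints\<close>

lemma sum_atLeast1_split:
  fixes h :: "nat \<Rightarrow> real"
  assumes "m \<le> n"
  shows "sum h {1..n} = sum h {1..m} + sum h {m<..n}"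
proof -
  have "{1..n} = {1..m} \<union> {m<..n}" "{1..m} \<inter> {m<..n} = {}" using assms by auto
  then show ?thesis using sum.union_disjoint[of "{1..m}" "{m<..n}" h] by simp
qed

text \<open>Truncating the binary expansion of \<open>j\<close> at successive digits leads from \<open>j\<close> down to \<open>0\<close> in
\<open>r\<close> steps. The step at digit \<open>t\<close> is either void or runs over one dyadic interval of length
\<open>2\<^sup>t\<close>, so Cauchy--Schwarz over the \<open>r\<close> steps gives the bound. Allowing every dyadic interval on
the right makes it independent of \<open>j\<close>: this replaces a maximum over \<open>j\<close> by a sum.\<close>

lemma dyadic_chaining:
  fixes G :: "nat \<Rightarrow> real"
  assumes "j < 2 ^ r"
  shows "(G j - G 0)\<^sup>2 \<le> r * (\<Sum>t<r. \<Sum>s<2^(r-t). (G ((s+1) * 2^t) - G (s * 2^t))\<^sup>2)"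
proof -
  define d where "d t = (j div 2^t) * 2^t" for t
  have step: "(G (d t) - G (d (Suc t)))\<^sup>2 \<le> (\<Sum>s<2^(r-t). (G ((s+1) * 2^t) - G (s * 2^t))\<^sup>2)"
    if "t < r" for t
  proof (cases "even (j div 2^t)")
    case True
    then obtain q where q: "j div 2^t = 2*q" by blast
    then have "j div 2 ^ Suc t = q" by (simp add: div_mult2_eq mult.commute[of 2])
    then have "d (Suc t) = d t" by (simp add: d_def q)
    then show ?thesis by (simp add: sum_nonneg)
  next
    case False
    then obtain q where q: "j div 2^t = 2*q + 1" by (auto elim: oddE)
    have d1: "d t = (2*q+1) * 2^t" by (simp add: d_def q)
    have "j div 2 ^ Suc t = q"
      using q by (simp add: div_mult2_eq mult.commute[of 2])
    then have d2: "d (Suc t) = (2*q) * 2^t" by (simp add: d_def)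
    have "j div 2^t < 2^(r-t)"
    proof -
      have "(2::nat)^r = 2^(r-t) * 2^t"
        using that by (simp add: power_add[symmetric])
      then show ?thesis using assms by (simp add: less_mult_imp_div_less)
    qed
    then have "2*q \<in> {..<2^(r-t)}" using q by simp
    then show ?thesis unfolding d1 d2
      by (intro member_le_sum[where f="\<lambda>s. (G ((s+1) * 2^t) - G (s * 2^t))\<^sup>2" and i="2*q"]) auto
  qed
  have "G j - G 0 = (\<Sum>t<r. G (d t) - G (d (Suc t)))"
    by (subst sum_lessThan_telescope') (use assms in \<open>simp add: d_def\<close>)
  then have "(G j - G 0)\<^sup>2 \<le> (\<Sum>t<r. (G (d t) - G (d (Suc t)))\<^sup>2) * r"
    using sum_squared_le_sum_of_squares[of "\<lambda>t. G (d t) - G (d (Suc t))" "{..<r}"] by simp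
  also have "\<dots> \<le> (\<Sum>t<r. \<Sum>s<2^(r-t). (G ((s+1) * 2^t) - G (s * 2^t))\<^sup>2) * r"
    by (intro mult_right_mono sum_mono step) auto
  finally show ?thesis by (simp add: mult.commute)
qed

text \<open>Picks the dyadic level for the value \<open>y = F n\<close>: high enough that the checkpoints on both sides of
\<open>n\<close> lie below \<open>2\<^sup>r\<close>, and low enough that \<open>2\<^sup>r = O(y)\<close> and \<open>r = O(ln y)\<close>.\<close>

lemma dyadic_scale:
  fixes y :: real
  assumes "4 \<le> y"
  shows "\<exists>r::nat. y + 1 < 2^r \<and> 2^r \<le> 4 * y \<and> r \<le> 3 * ln y"
proof -
  define l where "l = log 2 (2 * y)"
  define r where "r = nat \<lfloor>l\<rfloor> + 1"
  have l0: "0 \<le> l" using assms by (simp add: l_def)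
  have r1: "l < r" and r2: "r \<le> l + 1" unfolding r_def using l0 by linarith+
  have e: "2 powr l = 2 * y" using assms by (simp add: l_def)
  have "2 powr l < 2 powr real r" using r1 by simp
  then have "2 * y < 2^r" by (simp add: e powr_realpow)
  moreover have "2 powr real r \<le> 2 powr (l + 1)" using r2 by simp
  then have "2^r \<le> 4 * y" by (simp add: e powr_add powr_realpow)
  moreover have "r \<le> 3 * ln y"
  proof -
    have "log 2 (4::real) = 2" using log_pow_cancel[of 2 2] by simp
    then have "l + 1 = log 2 (4 * y)" using assms by (simp add: l_def log_mult)
    also have "\<dots> \<le> log 2 (y * y)" using assms by (simp add: mult_right_mono)
    also have "\<dots> = 2 * (ln y / ln 2)" using assms by (simp add: log_def ln_mult)
    also have "\<dots> \<le> 3 * ln y"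
    proof -
      have "ln y * 2 \<le> ln y * (3 * ln 2)"
        using ln2_ge_two_thirds assms by (intro mult_left_mono) auto
      then show ?thesis by (simp add: field_simps)
    qed
    finally show ?thesis using r2 by linarith
  qed
  ultimately show ?thesis using assms by (intro exI[of _ r]) auto
qed

text \<open>The fourth property goes one checkpoint further to the left than one might expect: as \<open>F\<close> may be constant for a while,
\<open>v j\<close> can lie beyond \<open>n\<close> even though \<open>j \<le> F n\<close>, but \<open>v (j - 1)\<close> cannot.\<close>

lemma unit_checkpoints:
  fixes F :: "nat \<Rightarrow> real"
  assumes "mono F" "F 0 = 0" and step: "\<And>n. F (Suc n) \<le> F n + B"
    and lim: "filterlim F at_top sequentially"
  obtains v :: "nat \<Rightarrow> nat" where "mono v"
    "\<And>j. F (v j) \<le> j" "\<And>j. j - B \<le> F (v j)"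
    "\<And>j n. j \<le> F n \<Longrightarrow> 1 \<le> j \<Longrightarrow> v (j - 1) \<le> n"
    "\<And>j n. F n \<le> j \<Longrightarrow> n \<le> v j"
proof -
  \<comment> \<open>The last time at which \<open>F\<close> has not yet exceeded \<open>j\<close>, written as a least element.\<close>
  define v where "v j = (LEAST n. F (Suc n) > real j)" for j :: nat
  have ex: "\<exists>n. F (Suc n) > real j" for j
  proof -
    have "eventually (\<lambda>n. F n > real j) sequentially"
      using lim by (simp add: filterlim_at_top_dense)
    then obtain n where "F n > real j" by (auto simp: eventually_sequentially)
    then have "F (Suc n) > real j" using monoD[OF \<open>mono F\<close>, of n "Suc n"] by simp
    then show ?thesis ..
  qed
  have up: "F (Suc (v j)) > real j" for j unfolding v_def by (rule LeastI_ex[OF ex])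
  have lo: "F (v j) \<le> j" for j
  proof (cases "v j")
    case 0 then show ?thesis using assms(2) by simp
  next
    case (Suc n)
    then have "\<not> F (Suc n) > real j" unfolding v_def
      by (intro not_less_Least) simp
    then show ?thesis using Suc by simp
  qed
  have less: "m < n" if "F m < F n" for m n
    using that monoD[OF \<open>mono F\<close>, of n m] by (meson leI linorder_not_less)
  show ?thesis
  proof
    show "mono v"
    proof (rule monoI)
      fix i j :: nat assume "i \<le> j"
      then have "F (v i) < F (Suc (v j))" using lo[of i] up[of j] by simp
      from less[OF this] show "v i \<le> v j" by simp
    qed
    show "F (v j) \<le> j" for j by (rule lo)
    show "j - B \<le> F (v j)" for j using up[of j] step[of "v j"] by simp
    show "v (j - 1) \<le> n" if "j \<le> F n" "1 \<le> j" for j n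
    proof -
      have "real (j - 1) < real j" using that by simp
      then have "F (v (j - 1)) < F n" using lo[of "j - 1"] that by linarith
      from less[OF this] show ?thesis by simp
    qed
    show "n \<le> v j" if "F n \<le> j" for j n
    proof -
      have "F n < F (Suc (v j))" using up[of j] that by simp
      from less[OF this] show ?thesis by simp
    qed
  qed
qed

text \<open>The part of the argument that concerns a single sample point: \<open>b k\<close> is the value of the \<open>k\<close>-th
variable at that point and \<open>a k\<close> its mean. Chaining controls the deviation at checkpoints. Since \<open>b\<close> is
nonnegative, the deviation between two checkpoints can only fall by as much as the mean grows, so
the values at the neighbouring checkpoints determine it up to a constant.\<close>

lemma path_bound_from_dyadic_squares:
  fixes b a \<phi> F S :: "nat \<Rightarrow> real" and v :: "nat \<Rightarrow> nat" and c e B :: real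
  defines "F \<equiv> \<lambda>n. \<Sum>k=1..n. \<phi> k"
  defines "S \<equiv> \<lambda>n. \<Sum>k=1..n. b k - a k"
  assumes b: "\<And>k. 0 \<le> b k" and a: "\<And>k. 0 \<le> a k" "\<And>k. a k \<le> \<phi> k"
    and lim: "filterlim F at_top sequentially"
    and v: "mono v" "\<And>j. F (v j) \<le> j" "\<And>j. j - B \<le> F (v j)"
      "\<And>j n. j \<le> F n \<Longrightarrow> 1 \<le> j \<Longrightarrow> v (j - 1) \<le> n" "\<And>j n. F n \<le> j \<Longrightarrow> n \<le> v j"
    and e: "0 \<le> e" and c: "0 \<le> c"
    and squares: "\<And>r. 1 \<le> r \<Longrightarrow>
        (\<Sum>t<r. \<Sum>s<2^(r-t). (S (v ((s+1) * 2^t)) - S (v (s * 2^t)))\<^sup>2)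
          \<le> c * (2^r * real r powr (2 + 2 * e))"
  shows "S \<in> O(\<lambda>n. F n powr (1/2) * ln (F n) powr (3/2 + e))"
proof -
  have diff: "S n - S m = (\<Sum>k\<in>{m<..n}. b k - a k)" 
       "F n - F m = (\<Sum>k\<in>{m<..n}. \<phi> k)" if "m \<le> n" for m n
    unfolding S_def F_def sum_atLeast1_split[OF that] by simp_all
  have drop: "S m - (F n - F m) \<le> S n" if "m \<le> n" for m n
  proof -
    have "- (\<Sum>k\<in>{m<..n}. \<phi> k) \<le> (\<Sum>k\<in>{m<..n}. b k - a k)"
      unfolding sum_negf[symmetric] by (intro sum_mono) (smt (verit) a(2) b)
    then show ?thesis using diff[OF that] by simp
  qed
  have phi: "0 \<le> \<phi> k" for k using a[of k] by simp
  have F_mono: "F m \<le> F n" if "m \<le> n" for m n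
    unfolding F_def using that by (intro sum_mono2) (auto simp: phi)
  \<comment> \<open>Chaining gives \<open>c r\<^sup>3\<^sup>+\<^sup>2\<^sup>e 2\<^sup>r\<close> for the square; with \<open>2\<^sup>r \<le> 4 y\<close> and \<open>r \<le> 3 ln y\<close>, \<open>D\<close> is the
    root of the constants.\<close>
  define D where "D = sqrt c * 2 * 3 powr (3/2 + e)"
  \<comment> \<open>The checkpoint \<open>v 0\<close> need not be \<open>0\<close>, so its deviation enters as an additive constant.\<close>
  define A where "A = \<bar>S (v 0)\<bar> + (2 + B)"
  have B: "0 \<le> B" using v(2)[of 0] v(3)[of 0] by simp
  have main: "\<bar>S n\<bar> \<le> (D + A) * (F n powr (1/2) * ln (F n) powr (3/2 + e))" if n: "4 \<le> F n" for n
  proof -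
    define y where "y = F n"
    define L where "L = y powr (1/2) * ln y powr (3/2 + e)"
    have y: "4 \<le> y" using n by (simp add: y_def)
    have "exp 1 \<le> (3::real)" by (rule exp_le)
    then have lny: "1 \<le> ln y" using y by (subst ln_ge_iff) auto
    have L1: "1 \<le> L"
    proof -
      have "1 * 1 \<le> y powr (1/2) * ln y powr (3/2 + e)"
        using y lny e by (intro mult_mono ge_one_powr_ge_zero) auto
      then show ?thesis by (simp add: L_def)
    qed
    obtain r :: nat where r: "y + 1 < 2^r" "2^r \<le> 4 * y" "r \<le> 3 * ln y"
      using dyadic_scale[OF y] by blast
    have r1: "1 \<le> r" using r(1) y by (cases r) auto
    have G: "\<bar>S (v i)\<bar> \<le> \<bar>S (v 0)\<bar> + D * L" if "real i \<le> y + 1" for i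
    proof -
      have "real i < real (2^r)"
        using that r(1) unfolding of_nat_power of_nat_numeral by linarith
      then have "i < 2^r" by (rule of_nat_less_imp_less)
      from dyadic_chaining[OF this, of "\<lambda>j. S (v j)"]
      have "(S (v i) - S (v 0))\<^sup>2 \<le> r * (c * (2^r * real r powr (2 + 2 * e)))"
        using squares[OF r1] by (meson mult_left_mono of_nat_0_le_iff order_trans)
      also have "\<dots> \<le> r * (c * (4 * y * real r powr (2 + 2 * e)))"
        using r(2) c by (intro mult_left_mono mult_right_mono) auto
      also have "\<dots> = c * (4 * y) * real r powr (3 + 2 * e)"
      proof -
        have "real r powr (3 + 2 * e) = real r powr (1 + (2 + 2 * e))" by simp
        also have "\<dots> = real r * real r powr (2 + 2 * e)"
          using r1 by (subst powr_add) simp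
        finally show ?thesis by (simp only: mult_ac)
      qed
      also have "\<dots> \<le> c * (4 * y) * (3 * ln y) powr (3 + 2 * e)"
        using r(3) r1 c y e by (intro mult_left_mono powr_mono2) auto
      also have "\<dots> = (D * L)\<^sup>2"
      proof -
        have sq: "(u powr p)\<^sup>2 = u powr (2 * p)" for u p :: real
          by (simp add: power2_eq_square flip: powr_add)
        have "(D * L)\<^sup>2 = (sqrt c)\<^sup>2 * 2\<^sup>2 * (y powr (1/2))\<^sup>2
            * ((3 powr (3/2 + e))\<^sup>2 * (ln y powr (3/2 + e))\<^sup>2)"
          unfolding D_def L_def power_mult_distrib by (simp only: mult_ac)
        also have "(y powr (1/2))\<^sup>2 = y" using y by (simp add: sq)
        also have "(3 powr (3/2 + e))\<^sup>2 * (ln y powr (3/2 + e))\<^sup>2 = (3 * ln y) powr (3 + 2 * e)"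
          using lny by (simp add: powr_mult sq[unfolded power2_eq_square] power2_eq_square distrib_left)
        finally show ?thesis using c by simp
      qed
      finally have "\<bar>S (v i) - S (v 0)\<bar>\<^sup>2 \<le> (D * L)\<^sup>2" by (simp only: power2_abs)
      moreover have "0 \<le> D * L" using L1 c by (simp add: D_def)
      ultimately have "\<bar>S (v i) - S (v 0)\<bar> \<le> D * L" by (rule power2_le_imp_le)
      then show ?thesis by linarith
    qed
    define j where "j = nat \<lfloor>y\<rfloor>"
    have j: "real j \<le> y" "y < real j + 1" "1 \<le> j" using y unfolding j_def by linarith+
    have v1: "v (j - 1) \<le> n" using v(4) j by (simp add: y_def)
    have v2: "n \<le> v (j + 1)" using v(5)[of n "j + 1"] j by (simp add: y_def)
    have "F (v (j + 1)) - F (v (j - 1)) \<le> 2 + B"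
      using v(2)[of "j + 1"] v(3)[of "j - 1"] j by (simp add: of_nat_diff)
    then have "S (v (j - 1)) - (2 + B) \<le> S n" "S n \<le> S (v (j + 1)) + (2 + B)"
      using drop[OF v1] drop[OF v2] F_mono[OF v1] F_mono[OF v2] by linarith+
    moreover have "\<bar>S (v (j - 1))\<bar> \<le> \<bar>S (v 0)\<bar> + D * L" "\<bar>S (v (j + 1))\<bar> \<le> \<bar>S (v 0)\<bar> + D * L"
      using j by (intro G; simp add: of_nat_diff)+
    ultimately have "\<bar>S n\<bar> \<le> D * L + A * 1" unfolding A_def mult_1_right by linarith
    also have "\<dots> \<le> D * L + A * L" using L1 B by (intro add_left_mono mult_left_mono) (auto simp: A_def)
    finally show ?thesis by (simp add: L_def y_def algebra_simps)
  qed
  have "eventually (\<lambda>n. 4 \<le> F n) sequentially" using lim by (simp add: filterlim_at_top)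
  then show ?thesis
    by (intro bigoI[of _ "D + A"]) (auto elim!: eventually_mono dest!: main)
qed

section \<open>A strong law from variance bounds on blocks\<close>

text \<open>Dividing by \<open>2\<^sup>r r\<^sup>2\<^sup>+\<^sup>2\<^sup>e\<close> leaves means of order \<open>r\<^sup>-\<^sup>1\<^sup>-\<^sup>2\<^sup>e\<close>, which are summable. The series of the
quotients is therefore almost surely finite, and its value serves as \<open>c\<close>. Making
them summable is what costs the \<open>\<epsilon>\<close> in the exponent of the logarithm.\<close>

lemma AE_dyadic_squares_bound:
  fixes Z :: "nat \<Rightarrow> 'a \<Rightarrow> real" and K e :: real
  assumes Z[measurable]: "\<And>r. Z r \<in> borel_measurable M" and nonneg: "\<And>r x. 0 \<le> Z r x"
    and "0 < e" "0 \<le> K"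
    and moment: "\<And>r. (\<integral>\<^sup>+x. ennreal (Z r x) \<partial>M) \<le> ennreal (K * (real r * 2^r))"
  shows "AE x in M. \<exists>c\<ge>0. \<forall>r\<ge>1. Z r x \<le> c * (2^r * real r powr (2 + 2 * e))"
proof -
  define w where "w r = 2^r * real r powr (2 + 2 * e)" for r :: nat
  have w: "0 < w (Suc r)" for r by (simp add: w_def)
  \<comment> \<open>The level \<open>r = 0\<close> is left out because \<open>w 0 = 0\<close>.\<close>
  have "(\<integral>\<^sup>+x. (\<Sum>r. ennreal (Z (Suc r) x / w (Suc r))) \<partial>M)
      = (\<Sum>r. \<integral>\<^sup>+x. ennreal (Z (Suc r) x / w (Suc r)) \<partial>M)"
    by (intro nn_integral_suminf) auto
  also have "\<dots> \<le> (\<Sum>r. ennreal (K * real (Suc r) powr (-1 - 2 * e)))"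
  proof (intro suminf_le)
    fix r
    let ?i = "ennreal (1 / w (Suc r))"
    have "(\<integral>\<^sup>+x. ennreal (Z (Suc r) x / w (Suc r)) \<partial>M)
        = (\<integral>\<^sup>+x. ?i * ennreal (Z (Suc r) x) \<partial>M)"
      using w[of r] nonneg by (simp flip: ennreal_mult)
    also have "\<dots> = ?i * (\<integral>\<^sup>+x. ennreal (Z (Suc r) x) \<partial>M)"
      by (intro nn_integral_cmult) auto
    also have "\<dots> \<le> ?i * ennreal (K * (real (Suc r) * 2^Suc r))"
      by (intro mult_left_mono moment) auto
    also have "\<dots> = ennreal (1 / w (Suc r) * (K * (real (Suc r) * 2^Suc r)))"
      using w[of r] \<open>0 \<le> K\<close> by (subst ennreal_mult) auto
    also have "1 / w (Suc r) * (K * (real (Suc r) * 2^Suc r)) = K * (real (Suc r) / real (Suc r) powr (2 + 2 * e))"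
      by (simp add: w_def field_simps del: of_nat_Suc)
    also have "real (Suc r) / real (Suc r) powr (2 + 2 * e) = real (Suc r) powr (-1 - 2 * e)"
      using powr_diff[of "real (Suc r)" 1 "2 + 2 * e"] by (simp add: algebra_simps)
    finally show "(\<integral>\<^sup>+x. ennreal (Z (Suc r) x / w (Suc r)) \<partial>M)
        \<le> ennreal (K * real (Suc r) powr (-1 - 2 * e))" .
  qed auto
  also have "\<dots> < \<infinity>"
  proof -
    have "summable (\<lambda>n. real n powr (-1 - 2 * e))"
      using \<open>0 < e\<close> by (simp add: summable_real_powr_iff)
    then have "summable (\<lambda>r. K * real (Suc r) powr (-1 - 2 * e))"
      by (intro summable_mult) (subst summable_Suc_iff)
    then show ?thesis
      using \<open>0 \<le> K\<close> by (subst suminf_ennreal2) (auto simp del: of_nat_Suc)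
  qed
  finally have "AE x in M. (\<Sum>r. ennreal (Z (Suc r) x / w (Suc r))) \<noteq> \<infinity>"
    by (intro nn_integral_noteq_infinite) auto
  then show ?thesis
  proof eventually_elim
    case (elim x)
    define c where "c = enn2real (\<Sum>r. ennreal (Z (Suc r) x / w (Suc r)))"
    have "Z r x \<le> c * w r" if "1 \<le> r" for r
    proof -
      obtain q where q: "r = Suc q" using \<open>1 \<le> r\<close> by (cases r) auto
      have "ennreal (Z r x / w r) \<le> (\<Sum>r. ennreal (Z (Suc r) x / w (Suc r)))"
        using sum_le_suminf[of "\<lambda>r. ennreal (Z (Suc r) x / w (Suc r))" "{q}"] by (simp add: q)
      also have "\<dots> = ennreal c" using elim by (simp add: c_def less_top)
      finally have "Z r x / w r \<le> c" by (simp add: c_def)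
      then show ?thesis using w[of q] by (simp add: q field_simps)
    qed
    then show ?case by (intro exI[of _ c]) (auto simp: c_def w_def)
  qed
qed

text \<open>The moment bound is additive over blocks of indices. The dyadic intervals of a fixed length between
checkpoints are disjoint blocks below \<open>v (2\<^sup>r)\<close>, so their moments telescope to at most
\<open>K 2\<^sup>r\<close>, and the \<open>r\<close> lengths together give \<open>K r 2\<^sup>r\<close>. The comparison sequence
\<open>\<phi>\<close> is allowed to exceed the means \<open>a\<close>, which leaves room for an error term in the variance.\<close>

lemma gal_koksma_strong_law:
  fixes f :: "nat \<Rightarrow> 'a \<Rightarrow> real" and a \<phi> :: "nat \<Rightarrow> real" and B K e :: real
  defines "F \<equiv> \<lambda>n. \<Sum>k=1..n. \<phi> k"
  assumes meas: "\<And>k. 1 \<le> k \<Longrightarrow> f k \<in> borel_measurable M"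
    and f: "\<And>k x. 0 \<le> f k x" 
    and a: "\<And>k. 0 \<le> a k" "\<And>k. a k \<le> \<phi> k" and B: "\<And>k. \<phi> k \<le> B"
    and moment: "\<And>m n. (\<integral>\<^sup>+x. ennreal ((\<Sum>k\<in>{m<..n}. f k x - a k)\<^sup>2) \<partial>M)
        \<le> ennreal (K * (\<Sum>k\<in>{m<..n}. \<phi> k))"
    and K: "0 \<le> K" and e: "0 < e"
    and lim: "filterlim F at_top sequentially"
  shows "AE x in M. (\<lambda>n. \<Sum>k=1..n. f k x - a k)
    \<in> O(\<lambda>n. F n powr (1/2) * ln (F n) powr (3/2 + e))"
proof -
  have phi: "0 \<le> \<phi> k" for k using a[of k] by simp
  have F_mono: "mono F"
    unfolding F_def by (intro monoI sum_mono2) (auto simp: phi)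
  have F_nonneg: "0 \<le> F n" for n unfolding F_def by (intro sum_nonneg phi)
  obtain v :: "nat \<Rightarrow> nat" where v: "mono v"
    "\<And>j. F (v j) \<le> j" "\<And>j. j - B \<le> F (v j)"
    "\<And>j n. j \<le> F n \<Longrightarrow> 1 \<le> j \<Longrightarrow> v (j - 1) \<le> n"
    "\<And>j n. F n \<le> j \<Longrightarrow> n \<le> v j"
  proof (rule unit_checkpoints[OF F_mono, of B])
    show "F 0 = 0" by (simp add: F_def)
    show "F (Suc n) \<le> F n + B" for n using B[of "Suc n"] by (simp add: F_def)
  qed (use lim in auto)
  define S where "S x n = (\<Sum>k=1..n. f k x - a k)" for x n
  define Z where "Z r x = (\<Sum>t<r. \<Sum>s<2^(r-t). (S x (v ((s+1) * 2^t)) - S x (v (s * 2^t)))\<^sup>2)" for r x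
  have S_meas[measurable]: "(\<lambda>x. S x n) \<in> borel_measurable M" for n
    unfolding S_def using meas by (intro borel_measurable_sum borel_measurable_diff) auto
  have moment_S: "(\<integral>\<^sup>+x. ennreal ((S x n - S x m)\<^sup>2) \<partial>M) \<le> ennreal (K * (F n - F m))" if "m \<le> n" for m n
    using moment[of m n] unfolding S_def F_def sum_atLeast1_split[OF that] by simp
  have Z_moment: "(\<integral>\<^sup>+x. ennreal (Z r x) \<partial>M) \<le> ennreal (K * (real r * 2^r))" for r
  proof -
    have "(\<integral>\<^sup>+x. ennreal (Z r x) \<partial>M)
        = (\<Sum>t<r. \<Sum>s<2^(r-t). \<integral>\<^sup>+x. ennreal ((S x (v ((s+1) * 2^t)) - S x (v (s * 2^t)))\<^sup>2) \<partial>M)"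
    proof -
      have "ennreal (Z r x)
          = (\<Sum>t<r. \<Sum>s<2^(r-t). ennreal ((S x (v ((s+1) * 2^t)) - S x (v (s * 2^t)))\<^sup>2))" for x
        unfolding Z_def by (simp only: sum_ennreal sum_nonneg zero_le_power2)
      then show ?thesis by (simp add: nn_integral_sum del: sum_ennreal)
    qed
    also have "\<dots> \<le> (\<Sum>t<r. \<Sum>s<2^(r-t). ennreal (K * (F (v ((s+1) * 2^t)) - F (v (s * 2^t)))))"
      by (intro sum_mono moment_S monoD[OF v(1)]) simp
    also have "\<dots> = ennreal (\<Sum>t<r. \<Sum>s<2^(r-t). K * (F (v ((s+1) * 2^t)) - F (v (s * 2^t))))"
    proof -
      have "0 \<le> K * (F (v ((s+1) * 2^t)) - F (v (s * 2^t)))" for s t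
        using K monoD[OF F_mono monoD[OF v(1)], of "s * 2^t" "(s+1) * 2^t"] by simp
      then show ?thesis by (simp only: sum_ennreal sum_nonneg)
    qed
    also have "(\<Sum>t<r. \<Sum>s<2^(r-t). K * (F (v ((s+1) * 2^t)) - F (v (s * 2^t)))) \<le> (\<Sum>t<r. K * 2^r)"
    proof (intro sum_mono)
      fix t assume t: "t \<in> {..<r}"
      have "(\<Sum>s<2^(r-t). K * (F (v ((s+1) * 2^t)) - F (v (s * 2^t))))
          = K * (\<Sum>s<2^(r-t). F (v (Suc s * 2^t)) - F (v (s * 2^t)))"
        unfolding Suc_eq_plus1 by (rule sum_distrib_left[symmetric])
      also have "\<dots> = K * (F (v (2^(r-t) * 2^t)) - F (v 0))"
        unfolding sum_lessThan_telescope[of "\<lambda>s. F (v (s * 2^t))"] by simp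
      also have "(2::nat)^(r-t) * 2^t = 2^r" using t by (simp flip: power_add)
      also have "F (v (2^r)) - F (v 0) \<le> 2^r"
        using v(2)[of "2^r"] F_nonneg[of "v 0"] by simp
      finally show "(\<Sum>s<2^(r-t). K * (F (v ((s+1) * 2^t)) - F (v (s * 2^t)))) \<le> K * 2^r"
        using K by (simp add: mult_left_mono)
    qed
    finally show ?thesis by (simp add: mult.left_commute ennreal_leI)
  qed
  have "AE x in M. \<exists>c\<ge>0. \<forall>r\<ge>1. Z r x \<le> c * (2^r * real r powr (2 + 2 * e))"
  proof (rule AE_dyadic_squares_bound[OF _ _ e K])
    show "Z r \<in> borel_measurable M" for r unfolding Z_def by measurable
    show "0 \<le> Z r x" for r x unfolding Z_def by (intro sum_nonneg) simp
  qed (rule Z_moment)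
  then show ?thesis
  proof eventually_elim
    case (elim x)
    then obtain c where c: "0 \<le> c" "\<And>r. 1 \<le> r \<Longrightarrow> Z r x \<le> c * (2^r * real r powr (2 + 2 * e))"
      by blast
    show ?case unfolding F_def
    proof (rule path_bound_from_dyadic_squares[where c=c and B=B and v=v, folded F_def])
      show "(\<Sum>t<r. \<Sum>s<2^(r-t). ((\<Sum>k=1..v ((s+1) * 2^t). f k x - a k)
          - (\<Sum>k=1..v (s * 2^t). f k x - a k))\<^sup>2) \<le> c * (2^r * real r powr (2 + 2 * e))"
        if "1 \<le> r" for r
        using c(2)[OF that] by (simp only: Z_def S_def)
    qed (fact a f less_imp_le[OF e] c(1) lim[unfolded F_def] v[unfolded F_def])+
  qed
qed

text \<open>A bounded perturbation of a scale that tends to infinity changes it, and its logarithm, by a factor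
of at most \<open>2\<close> in the end; this removes the summable error from the final rate.\<close>

lemma bigo_shift_scale:
  fixes F \<Phi> :: "nat \<Rightarrow> real"
  assumes lim: "filterlim \<Phi> at_top sequentially"
    and F: "\<And>n. \<Phi> n \<le> F n" "\<And>n. F n \<le> \<Phi> n + R" and "0 \<le> p" "0 \<le> q"
  shows "(\<lambda>n. F n powr p * ln (F n) powr q) \<in> O(\<lambda>n. \<Phi> n powr p * ln (\<Phi> n) powr q)"
proof (rule bigoI)
  have "eventually (\<lambda>n. max 2 R \<le> \<Phi> n) sequentially"
    using lim unfolding filterlim_at_top by blast
  then show "eventually (\<lambda>n. norm (F n powr p * ln (F n) powr q)
      \<le> 2 powr p * 2 powr q * norm (\<Phi> n powr p * ln (\<Phi> n) powr q)) sequentially"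
  proof eventually_elim
    case (elim n)
    then have n: "2 \<le> \<Phi> n" "R \<le> \<Phi> n" by auto
    have "F n \<le> \<Phi> n * \<Phi> n"
      using n F(2)[of n] mult_right_mono[of 2 "\<Phi> n" "\<Phi> n"] by linarith
    then have "ln (F n) \<le> ln (\<Phi> n * \<Phi> n)"
      using n F(1)[of n] by (subst ln_le_cancel_iff) auto
    then have "ln (F n) \<le> 2 * ln (\<Phi> n)" using n by (simp add: ln_mult)
    moreover have "F n \<le> 2 * \<Phi> n" using n F(2)[of n] by simp
    moreover have "0 \<le> ln (F n)" "0 < F n" "0 < ln (\<Phi> n)" using n F(1)[of n] by auto
    ultimately have "F n powr p * ln (F n) powr q \<le> (2 * \<Phi> n) powr p * (2 * ln (\<Phi> n)) powr q"
      using assms by (intro mult_mono powr_mono2) auto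
    then show ?case using n by (simp add: powr_mult mult_ac)
  qed
qed

section \<open>Covariances of quasi-independent events\<close>

lemma sum_symmetric_split:
  fixes c :: "nat \<Rightarrow> nat \<Rightarrow> real"
  assumes "finite A" and sym: "\<And>k l. c k l = c l k"
  shows "(\<Sum>k\<in>A. \<Sum>l\<in>A. c k l) = (\<Sum>k\<in>A. c k k) + 2 * (\<Sum>k\<in>A. \<Sum>l\<in>{l\<in>A. k < l}. c k l)"
proof -
  have row: "(\<Sum>l\<in>A. c k l) = c k k + (\<Sum>l\<in>{l\<in>A. l < k}. c k l) + (\<Sum>l\<in>{l\<in>A. k < l}. c k l)"
    if "k \<in> A" for k
  proof -
    have "A = insert k ({l\<in>A. l < k} \<union> {l\<in>A. k < l})" using that by auto
    then have "(\<Sum>l\<in>A. c k l) = sum (c k) (insert k ({l\<in>A. l < k} \<union> {l\<in>A. k < l}))" by (rule arg_cong)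
    also have "\<dots> = c k k + sum (c k) ({l\<in>A. l < k} \<union> {l\<in>A. k < l})"
      using \<open>finite A\<close> by (subst sum.insert) auto
    also have "sum (c k) ({l\<in>A. l < k} \<union> {l\<in>A. k < l})
        = (\<Sum>l\<in>{l\<in>A. l < k}. c k l) + (\<Sum>l\<in>{l\<in>A. k < l}. c k l)"
      using \<open>finite A\<close> by (subst sum.union_disjoint) auto
    finally show ?thesis by (simp only: add.assoc)
  qed
  have "(\<Sum>k\<in>A. \<Sum>l\<in>{l\<in>A. l < k}. c k l) = (\<Sum>l\<in>A. \<Sum>k\<in>{k\<in>A. l < k}. c k l)"
    by (rule sum.swap_restrict[OF \<open>finite A\<close> \<open>finite A\<close>])
  also have "\<dots> = (\<Sum>k\<in>A. \<Sum>l\<in>{l\<in>A. k < l}. c k l)" by (simp only: sym)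
  finally show ?thesis using row by (simp add: sum.distrib)
qed

text \<open>The two parts of the bound on \<open>c\<close> are summed in different orders. The part \<open>h k d\<close> is summed over
the gap \<open>d\<close> for a fixed first index, and charged to \<open>k\<close>. The part \<open>a (k + d) * q k\<close> is summed over
the first index for a fixed second one, and charged to \<open>l = k + d\<close>.\<close>

lemma sum_above_diagonal_le:
  fixes c h :: "nat \<Rightarrow> nat \<Rightarrow> real" and a q u :: "nat \<Rightarrow> real"
  assumes A: "finite A" "A \<subseteq> {1..}"
    and c: "\<And>k d. 1 \<le> k \<Longrightarrow> 1 \<le> d \<Longrightarrow> c k (k + d) \<le> h k d + a (k + d) * q k"
    and h: "\<And>k D. 1 \<le> k \<Longrightarrow> finite D \<Longrightarrow> D \<subseteq> {1..} \<Longrightarrow> sum (h k) D \<le> u k"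
    and q: "\<And>k. 0 \<le> q k" "\<And>D. finite D \<Longrightarrow> sum q D \<le> Q"
    and a: "\<And>k. 0 \<le> a k"
  shows "(\<Sum>k\<in>A. \<Sum>l\<in>{l\<in>A. k < l}. c k l) \<le> sum u A + Q * sum a A"
proof -
  have "(\<Sum>k\<in>A. \<Sum>l\<in>{l\<in>A. k < l}. c k l) \<le> (\<Sum>k\<in>A. \<Sum>l\<in>{l\<in>A. k < l}. h k (l - k) + a l * q k)"
  proof (intro sum_mono)
    fix k l assume "k \<in> A" "l \<in> {l\<in>A. k < l}"
    then show "c k l \<le> h k (l - k) + a l * q k" using c[of k "l - k"] A by auto
  qed
  also have "\<dots> = (\<Sum>k\<in>A. \<Sum>l\<in>{l\<in>A. k < l}. h k (l - k)) + (\<Sum>k\<in>A. \<Sum>l\<in>{l\<in>A. k < l}. a l * q k)"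
    by (simp only: sum.distrib)
  also have "(\<Sum>k\<in>A. \<Sum>l\<in>{l\<in>A. k < l}. h k (l - k)) \<le> sum u A"
  proof (intro sum_mono)
    fix k assume k: "k \<in> A"
    have "(\<Sum>l\<in>{l\<in>A. k < l}. h k (l - k)) = sum (h k) ((\<lambda>l. l - k) ` {l\<in>A. k < l})"
      by (subst sum.reindex) (auto simp: inj_on_def)
    also have "\<dots> \<le> u k" using k A by (intro h) auto
    finally show "(\<Sum>l\<in>{l\<in>A. k < l}. h k (l - k)) \<le> u k" .
  qed
  also have "(\<Sum>k\<in>A. \<Sum>l\<in>{l\<in>A. k < l}. a l * q k) = (\<Sum>l\<in>A. \<Sum>k\<in>{k\<in>A. k < l}. a l * q k)"
    by (rule sum.swap_restrict[OF A(1) A(1)])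
  also have "\<dots> \<le> (\<Sum>l\<in>A. Q * a l)"
  proof (intro sum_mono)
    fix l
    have "(\<Sum>k\<in>{k\<in>A. k < l}. a l * q k) = a l * sum q {k\<in>A. k < l}" by (rule sum_distrib_left[symmetric])
    also have "\<dots> \<le> a l * Q" using A a by (intro mult_left_mono q) auto
    finally show "(\<Sum>k\<in>{k\<in>A. k < l}. a l * q k) \<le> Q * a l" by (simp only: mult.commute)
  qed
  finally show ?thesis by (simp add: sum_distrib_left)
qed

lemma sum_truncated_const_le:
  fixes w X :: real
  assumes "finite D" "D \<subseteq> {1..}" "0 \<le> w" "0 \<le> X"
  shows "(\<Sum>d\<in>D. if real d \<le> X then w else 0) \<le> w * X"
proof -
  have "{d\<in>D. real d \<le> X} \<subseteq> {1..nat \<lfloor>X\<rfloor>}" using assms by (auto simp: le_nat_floor)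
  then have "card {d\<in>D. real d \<le> X} \<le> nat \<lfloor>X\<rfloor>" using card_mono[of "{1..nat \<lfloor>X\<rfloor>}"] by fastforce
  then have "real (card {d\<in>D. real d \<le> X}) \<le> X" using assms by linarith
  then show ?thesis using assms
    by (simp add: sum.If_cases Int_def mult.commute[of X] mult.commute[of _ w] mult_left_mono)
qed

text \<open>The terms are \<open>k\<close> to the power \<open>- s ln k\<close>, which eventually beats every fixed negative power.\<close>

lemma summable_exp_neg_ln_squared:
  fixes s :: real
  assumes "0 < s"
  shows "summable (\<lambda>k. exp (- s * (ln (real k))\<^sup>2))"
proof (rule summable_comparison_test_bigo)
  show "summable (\<lambda>k. norm (real k powr (-2)))" by (simp add: summable_real_powr_iff)
  show "(\<lambda>k. exp (- s * (ln (real k))\<^sup>2)) \<in> O(\<lambda>k. real k powr (-2))"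
    using assms by real_asymp
qed

lemma summable_linear_exp_neg:
  fixes s :: real
  assumes "0 < s"
  shows "summable (\<lambda>k. real k * exp (- s * real k))"
proof (rule summable_comparison_test_bigo)
  show "summable (\<lambda>k. norm (real k powr (-2)))" by (simp add: summable_real_powr_iff)
  show "(\<lambda>k. real k * exp (- s * real k)) \<in> O(\<lambda>k. real k powr (-2))"
    using assms by real_asymp
qed

lemma summable_exp_neg:
  fixes s :: real
  assumes "0 < s"
  shows "summable (\<lambda>k. exp (- s * real k))"
proof -
  have "exp (- s * real k) = exp (- s) ^ k" for k
    by (simp add: exp_of_nat_mult[symmetric] mult.commute)
  then show ?thesis using assms by (simp add: summable_geometric)
qed

text \<open>All three ranges of \<open>d\<close> are covered by one bound with nonnegative terms, so that a sum over
\<open>d\<close> need not be cut into ranges. Writing \<open>exp (- \<tau> d)\<close> as the square of \<open>exp (- \<tau>/2 d)\<close>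
and using \<open>d > (ln k)\<^sup>2\<close> in one factor only gives decay in \<open>k\<close> and keeps
summability in \<open>d\<close>. The number \<open>p\<close> stands for the measure of \<open>E k \<inter> E (k + d)\<close>.\<close>

lemma covariance_split:
  fixes a \<Psi> :: "nat \<Rightarrow> real" and p C N \<delta> \<tau> \<sigma> :: real
  assumes kd: "1 \<le> k" "1 \<le> d" and a: "\<And>k. 0 \<le> a k"
    and constants: "0 < C" "0 < \<tau>" "0 < \<sigma>" and Psi: "\<And>d. 0 \<le> \<Psi> d"
    and decorrelation: "p \<le> a k * a (k + d) + C * (exp (- \<tau> * real k) + exp (- \<tau> * real d))"
    and short_returns: "real d \<le> (ln (real k))\<^sup>2 \<Longrightarrow>
      p \<le> C * a k powr (1 + \<delta>) * ln (real k) powr N + a k * \<Psi> d"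
    and long_gaps: "real k \<le> \<sigma> * real d \<Longrightarrow>
      p \<le> a k * a (k + d) + C * a (k + d) * exp (- \<tau> * real k) + C * exp (- \<tau> * real d)"
  shows "p - a k * a (k + d)
    \<le> ((if real d \<le> (ln (real k))\<^sup>2 then C * a k powr (1 + \<delta>) * ln (real k) powr N else 0)
        + a k * \<Psi> d
        + C * exp (- (\<tau>/2) * (ln (real k))\<^sup>2) * exp (- (\<tau>/2) * real d)
        + (if real d \<le> real k / \<sigma> then C * exp (- \<tau> * real k) else 0))
      + a (k + d) * (C * exp (- \<tau> * real k))"
proof (cases "real d \<le> (ln (real k))\<^sup>2")
  case True
  moreover have "0 \<le> a k * a (k + d)" "0 \<le> a (k + d) * (C * exp (- \<tau> * real k))"
     "0 \<le> C * exp (- (\<tau>/2) * (ln (real k))\<^sup>2) * exp (- (\<tau>/2) * real d)"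
     "0 \<le> C * exp (- \<tau> * real k)"
    using a constants by simp_all
  ultimately show ?thesis using short_returns by auto
next
  case False
  have "exp (- \<tau> * real d) = exp (- (\<tau>/2) * real d) * exp (- (\<tau>/2) * real d)"
    by (simp flip: exp_add)
  also have "\<dots> \<le> exp (- (\<tau>/2) * (ln (real k))\<^sup>2) * exp (- (\<tau>/2) * real d)"
    using False constants by (intro mult_right_mono) auto
  finally have "C * exp (- \<tau> * real d)
      \<le> C * exp (- (\<tau>/2) * (ln (real k))\<^sup>2) * exp (- (\<tau>/2) * real d)"
    using constants by simp
  moreover have "0 \<le> a k * \<Psi> d" "0 \<le> a (k + d) * (C * exp (- \<tau> * real k))"
     "0 \<le> C * exp (- \<tau> * real k)"
    using a Psi constants by simp_all
  moreover have "real d \<le> real k / \<sigma> \<or> real k \<le> \<sigma> * real d"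
    using constants by (auto simp: field_simps)
  ultimately show ?thesis using False decorrelation long_gaps
    by (auto simp: algebra_simps)
qed

text \<open>The exponent \<open>(2 + N) / \<delta>\<close> is chosen for this estimate: raised to the power \<open>\<delta>\<close>, the bound on \<open>x\<close>
cancels \<open>(ln k)\<^sup>N\<close> and the \<open>(ln k)\<^sup>2\<close> coming from the number of short gaps. For
\<open>k = 1\<close> both logarithmic factors vanish.\<close>

lemma short_range_mass:
  fixes x C N \<delta> :: real
  assumes "1 \<le> k" "0 \<le> x" "0 < C" "0 < \<delta>" "0 < N"
    and bound: "2 \<le> k \<Longrightarrow> x \<le> C / ln (real k) powr ((2 + N) / \<delta>)"
  shows "C * x powr (1 + \<delta>) * ln (real k) powr N * (ln (real k))\<^sup>2 \<le> C * C powr \<delta> * x"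
proof (cases "k = 1 \<or> x = 0")
  case True
  then show ?thesis using assms by auto
next
  case False
  then have "2 \<le> k" using \<open>1 \<le> k\<close> by auto
  then have L: "0 < ln (real k)" by simp
  have "x powr \<delta> \<le> (C / ln (real k) powr ((2 + N) / \<delta>)) powr \<delta>"
    using assms bound[OF \<open>2 \<le> k\<close>] by (intro powr_mono2) auto
  also have "\<dots> = C powr \<delta> / ln (real k) powr (2 + N)"
    using assms by (simp add: powr_divide powr_powr)
  finally have *: "x powr \<delta> * ln (real k) powr (2 + N) \<le> C powr \<delta>"
    using L by (simp add: field_simps)
  have "ln (real k) powr N * (ln (real k))\<^sup>2 = ln (real k) powr (2 + N)"
    using L by (simp add: powr_add powr_numeral mult.commute)
  moreover have "x powr (1 + \<delta>) = x * x powr \<delta>"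
    using False assms by (simp add: powr_add)
  ultimately have "C * x powr (1 + \<delta>) * ln (real k) powr N * (ln (real k))\<^sup>2
      = C * x * (x powr \<delta> * ln (real k) powr (2 + N))"
    by (simp only: mult.assoc)
  also have "\<dots> \<le> C * x * C powr \<delta>" using assms * by (intro mult_left_mono) auto
  finally show ?thesis by (simp only: mult_ac)
qed

text \<open>The quasi-independence of the events, stated for the numbers \<open>a k\<close> and
\<open>p k l\<close> that stand for the measures of \<open>E k\<close> and \<open>E k \<inter> E l\<close>. The sequence
\<open>\<rho>\<close> collects the decorrelation errors that carry no factor \<open>a k\<close> or \<open>a l\<close>.\<close>

lemma covariance_sum_bound:
  fixes a \<Psi> :: "nat \<Rightarrow> real" and p :: "nat \<Rightarrow> nat \<Rightarrow> real" and C N \<delta> \<tau> \<sigma> :: real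
  assumes a: "\<And>k. 0 \<le> a k"
    and diag: "\<And>k. p k k \<le> a k" and sym: "\<And>k l. p k l = p l k"
    and constants: "0 < C" "0 < N" "0 < \<delta>" "0 < \<tau>" "0 < \<sigma>"
    and Psi: "\<And>d. 0 \<le> \<Psi> d" "summable \<Psi>"
    and measure_bound: "\<And>k. 2 \<le> k \<Longrightarrow> a k \<le> C / ln (real k) powr ((2 + N) / \<delta>)"
    and decorrelation: "\<And>k d. 1 \<le> k \<Longrightarrow> 1 \<le> d \<Longrightarrow>
      p k (k + d) \<le> a k * a (k + d) + C * (exp (- \<tau> * real k) + exp (- \<tau> * real d))"
    and short_returns: "\<And>k d. 1 \<le> k \<Longrightarrow> 1 \<le> d \<Longrightarrow> real d \<le> (ln (real k))\<^sup>2 \<Longrightarrow>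
      p k (k + d) \<le> C * a k powr (1 + \<delta>) * ln (real k) powr N + a k * \<Psi> d"
    and long_gaps: "\<And>k d. 1 \<le> k \<Longrightarrow> 1 \<le> d \<Longrightarrow> real k \<le> \<sigma> * real d \<Longrightarrow>
      p k (k + d) \<le> a k * a (k + d) + C * a (k + d) * exp (- \<tau> * real k) + C * exp (- \<tau> * real d)"
  obtains K :: real and \<rho> :: "nat \<Rightarrow> real"
  where "0 \<le> K" "\<And>k. 0 \<le> \<rho> k" "summable \<rho>"
    "\<And>A. finite A \<Longrightarrow> A \<subseteq> {1..} \<Longrightarrow>
      (\<Sum>k\<in>A. \<Sum>l\<in>A. p k l - a k * a l) \<le> K * (\<Sum>k\<in>A. a k + \<rho> k)"
proof -
  define G where "G = (\<Sum>d. exp (- (\<tau>/2) * real d))"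
  define Q where "Q = (\<Sum>k. C * exp (- \<tau> * real k))"
  define \<rho> where "\<rho> k = C * G * exp (- (\<tau>/2) * (ln (real k))\<^sup>2) + C / \<sigma> * (real k * exp (- \<tau> * real k))" for k
  define K0 where "K0 = C * C powr \<delta> + suminf \<Psi> + 1"
  define h where "h k d = (if real d \<le> (ln (real k))\<^sup>2 then C * a k powr (1 + \<delta>) * ln (real k) powr N else 0)
        + a k * \<Psi> d
        + C * exp (- (\<tau>/2) * (ln (real k))\<^sup>2) * exp (- (\<tau>/2) * real d)
        + (if real d \<le> real k / \<sigma> then C * exp (- \<tau> * real k) else 0)" for k d
  have sumG: "summable (\<lambda>d. exp (- (\<tau>/2) * real d))" using constants by (intro summable_exp_neg) simp
  have sumQ: "summable (\<lambda>k. C * exp (- \<tau> * real k))"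
    using constants by (intro summable_mult summable_exp_neg) simp
  have G: "0 \<le> G" unfolding G_def by (intro suminf_nonneg sumG) simp
  have Q: "0 \<le> Q" unfolding Q_def using constants by (intro suminf_nonneg sumQ) simp
  have SPsi: "0 \<le> suminf \<Psi>" using Psi by (intro suminf_nonneg) auto
  have K0: "1 \<le> K0" using SPsi constants by (simp add: K0_def)
  have rho: "0 \<le> \<rho> k" for k using G constants by (simp add: \<rho>_def)
  have h_sum: "sum (h k) D \<le> K0 * (a k + \<rho> k)" if "1 \<le> k" "finite D" "D \<subseteq> {1..}" for k D
  proof -
    have 1: "(\<Sum>d\<in>D. if real d \<le> (ln (real k))\<^sup>2 then C * a k powr (1 + \<delta>) * ln (real k) powr N else 0)
        \<le> C * C powr \<delta> * a k"
    proof (rule order_trans)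
      show "(\<Sum>d\<in>D. if real d \<le> (ln (real k))\<^sup>2 then C * a k powr (1 + \<delta>) * ln (real k) powr N else 0)
          \<le> C * a k powr (1 + \<delta>) * ln (real k) powr N * (ln (real k))\<^sup>2"
        using constants that by (intro sum_truncated_const_le) auto
      show "C * a k powr (1 + \<delta>) * ln (real k) powr N * (ln (real k))\<^sup>2 \<le> C * C powr \<delta> * a k"
        using that(1) constants by (intro short_range_mass a measure_bound)
    qed
    have 2: "(\<Sum>d\<in>D. a k * \<Psi> d) \<le> a k * suminf \<Psi>"
      unfolding sum_distrib_left[symmetric] using a Psi that
      by (intro mult_left_mono sum_le_suminf) auto
    have 3: "(\<Sum>d\<in>D. C * exp (- (\<tau>/2) * (ln (real k))\<^sup>2) * exp (- (\<tau>/2) * real d))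
        \<le> C * exp (- (\<tau>/2) * (ln (real k))\<^sup>2) * G"
      unfolding sum_distrib_left[symmetric] G_def using constants that
      by (intro mult_left_mono sum_le_suminf sumG) auto
    have 4: "(\<Sum>d\<in>D. if real d \<le> real k / \<sigma> then C * exp (- \<tau> * real k) else 0)
        \<le> C * exp (- \<tau> * real k) * (real k / \<sigma>)"
      using constants that by (intro sum_truncated_const_le) auto
    have "sum (h k) D \<le> (C * C powr \<delta> + suminf \<Psi>) * a k + \<rho> k"
      using 1 2 3 4 unfolding h_def sum.distrib \<rho>_def by (simp add: algebra_simps)
    also have "\<dots> \<le> K0 * a k + K0 * \<rho> k"
      using K0 a rho[of k] by (intro add_mono mult_right_mono) (auto simp: K0_def mult_le_cancel_right1)
    finally show ?thesis by (simp add: distrib_left)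
  qed
  have above: "(\<Sum>k\<in>A. \<Sum>l\<in>{l\<in>A. k < l}. p k l - a k * a l) \<le> (\<Sum>k\<in>A. K0 * (a k + \<rho> k)) + Q * sum a A"
    if A: "finite A" "A \<subseteq> {1..}" for A
  proof (rule sum_above_diagonal_le[where c = "\<lambda>k l. p k l - a k * a l" and h=h
        and q="\<lambda>k. C * exp (- \<tau> * real k)", OF A])
    show "p k (k + d) - a k * a (k + d) \<le> h k d + a (k + d) * (C * exp (- \<tau> * real k))"
      if "1 \<le> k" "1 \<le> d" for k d
      unfolding h_def using that
      by (intro covariance_split a constants Psi decorrelation short_returns long_gaps)
    show "(\<Sum>k\<in>D. C * exp (- \<tau> * real k)) \<le> Q" if "finite D" for D
      unfolding Q_def using that constants by (intro sum_le_suminf sumQ) auto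
  qed (use h_sum a constants in auto)
  show thesis
  proof (rule that[of "1 + 2 * (K0 + Q)" \<rho>])
    show "0 \<le> 1 + 2 * (K0 + Q)" using K0 Q by simp
    show "summable \<rho>" unfolding \<rho>_def using constants
      by (intro summable_add summable_mult summable_exp_neg_ln_squared summable_linear_exp_neg) auto
    show "(\<Sum>k\<in>A. \<Sum>l\<in>A. p k l - a k * a l) \<le> (1 + 2 * (K0 + Q)) * (\<Sum>k\<in>A. a k + \<rho> k)"
      if A: "finite A" "A \<subseteq> {1..}" for A
    proof -
      have "p k k - a k * a k \<le> a k" for k using diag[of k] by (smt (verit) zero_le_square)
      then have "(\<Sum>k\<in>A. p k k - a k * a k) \<le> (\<Sum>k\<in>A. a k)" by (intro sum_mono)
      moreover have le: "(\<Sum>k\<in>A. a k) \<le> (\<Sum>k\<in>A. a k + \<rho> k)" using rho by (intro sum_mono) simp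
      moreover have "Q * sum a A \<le> Q * (\<Sum>k\<in>A. a k + \<rho> k)" using le Q by (intro mult_left_mono)
      moreover have "(\<Sum>k\<in>A. \<Sum>l\<in>A. p k l - a k * a l) = (\<Sum>k\<in>A. p k k - a k * a k)
          + 2 * (\<Sum>k\<in>A. \<Sum>l\<in>{l\<in>A. k < l}. p k l - a k * a l)"
        using A(1) by (intro sum_symmetric_split) (simp_all add: sym mult.commute)
      ultimately show ?thesis using above[OF A]
        unfolding sum_distrib_left[symmetric] distrib_right by (simp add: algebra_simps)
    qed
  qed (rule rho)
qed

section \<open>Counting the events that contain a point\<close>

text \<open>The variance as a sum of covariances. It is stated as a nonnegative integral, the form in which
the strong law takes its moment hypothesis.\<close>

lemma (in prob_space) second_moment_centred_indicators:
  assumes "finite A" and E: "\<And>k. k \<in> A \<Longrightarrow> E k \<in> events"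
  shows "(\<integral>\<^sup>+x. ennreal ((\<Sum>k\<in>A. indicat_real (E k) x - prob (E k))\<^sup>2) \<partial>M)
    = ennreal (\<Sum>k\<in>A. \<Sum>l\<in>A. prob (E k \<inter> E l) - prob (E k) * prob (E l))"
proof -
  let ?g = "\<lambda>k l x. indicat_real (E k \<inter> E l) x - prob (E l) * indicat_real (E k) x
      - prob (E k) * indicat_real (E l) x + prob (E k) * prob (E l)"
  have sq: "(\<Sum>k\<in>A. indicat_real (E k) x - prob (E k))\<^sup>2 = (\<Sum>k\<in>A. \<Sum>l\<in>A. ?g k l x)" for x
    unfolding power2_eq_square sum_product
    by (intro sum.cong refl) (simp add: indicator_inter_arith algebra_simps)
  have int: "has_bochner_integral M (?g k l) (prob (E k \<inter> E l) - prob (E k) * prob (E l))"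
    if "k \<in> A" "l \<in> A" for k l
  proof -
    have ind: "has_bochner_integral M (indicat_real B) (prob B)" if "B \<in> events" for B
      using that by (intro has_bochner_integral_real_indicator) (auto simp: emeasure_eq_measure)
    have const: "has_bochner_integral M (\<lambda>x. b) b" for b :: real
      by (simp add: has_bochner_integral_iff prob_space)
    have "has_bochner_integral M (?g k l) (prob (E k \<inter> E l) - prob (E l) * prob (E k)
        - prob (E k) * prob (E l) + prob (E k) * prob (E l))"
      using E[OF that(1)] E[OF that(2)]
      by (intro has_bochner_integral_add has_bochner_integral_diff has_bochner_integral_mult_right
          ind const) auto
    then show ?thesis by (simp add: mult.commute)
  qed
  then have "has_bochner_integral M (\<lambda>x. \<Sum>k\<in>A. \<Sum>l\<in>A. ?g k l x)
      (\<Sum>k\<in>A. \<Sum>l\<in>A. prob (E k \<inter> E l) - prob (E k) * prob (E l))"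
    by (intro has_bochner_integral_sum) auto
  then have "has_bochner_integral M (\<lambda>x. (\<Sum>k\<in>A. indicat_real (E k) x - prob (E k))\<^sup>2)
      (\<Sum>k\<in>A. \<Sum>l\<in>A. prob (E k \<inter> E l) - prob (E k) * prob (E l))"
    by (simp only: sq)
  then show ?thesis
    by (simp add: has_bochner_integral_iff nn_integral_eq_integral)
qed

lemma (in prob_space) bounded_count_deviation:
  fixes E :: "nat \<Rightarrow> 'a set"
  assumes E: "\<And>k. 1 \<le> k \<Longrightarrow> E k \<in> events"
    and bnd: "bounded (range (\<lambda>n. \<Sum>k=1..n. prob (E k)))"
  shows "AE x in M. bounded (range (\<lambda>n. (\<Sum>k=1..n. indicat_real (E k) x) - (\<Sum>k=1..n. prob (E k))))"
proof -
  have shift: "(\<Sum>k=1..n. h k) = (\<Sum>k<n. h (Suc k))" for h :: "nat \<Rightarrow> real" and n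
    by (simp add: sum.atLeast1_atMost_eq)
  have "summable (\<lambda>k. prob (E (Suc k)))"
  proof -
    obtain b where b: "\<And>n. \<bar>\<Sum>k=1..n. prob (E k)\<bar> \<le> b"
      using bnd by (auto simp: bounded_iff)
    have "(\<Sum>k<n. prob (E (Suc k))) \<le> b" for n
      using b[of n] unfolding shift by simp
    then show ?thesis by (intro summableI_nonneg_bounded) auto
  qed
  then have "AE x in M. eventually (\<lambda>k. x \<in> space M - E (Suc k)) sequentially"
    using E by (intro borel_cantelli_AE1) (auto simp: emeasure_eq_measure)
  then show ?thesis
  proof eventually_elim
    case (elim x)
    then have "eventually (\<lambda>k. indicat_real (E (Suc k)) x = 0) sequentially"
      by eventually_elim auto
    then have "summable (\<lambda>k. indicat_real (E (Suc k)) x)"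
      using summable_cong[of "\<lambda>k. indicat_real (E (Suc k)) x" "\<lambda>_. 0"] by simp
    then have "bounded (range (\<lambda>n. \<Sum>k=1..n. indicat_real (E k) x))"
      unfolding shift by (intro convergent_imp_bounded) (rule summable_LIMSEQ)
    then show ?case using bnd by (rule bounded_minus_comp)
  qed
qed

text \<open>Adding \<open>\<rho>\<close> to the measures gives a comparison sequence that dominates both the means and, up to \<open>K\<close>,
the variances. Its partial sums differ from \<open>\<Phi>\<close> by at most the total of \<open>\<rho>\<close>, so the rate obtained in
terms of them is also a rate in terms of \<open>\<Phi>\<close>.\<close>

lemma (in prob_space) count_deviation_of_covariance_bound:
  fixes E :: "nat \<Rightarrow> 'a set" and \<rho> :: "nat \<Rightarrow> real" and K e :: real
  defines "\<Phi> \<equiv> \<lambda>n. \<Sum>k=1..n. prob (E k)"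
  assumes E: "\<And>k. 1 \<le> k \<Longrightarrow> E k \<in> events"
    and K: "0 \<le> K" and rho: "\<And>k. 0 \<le> \<rho> k" "summable \<rho>" and e: "0 < e"
    and cov: "\<And>A. finite A \<Longrightarrow> A \<subseteq> {1..} \<Longrightarrow>
      (\<Sum>k\<in>A. \<Sum>l\<in>A. prob (E k \<inter> E l) - prob (E k) * prob (E l)) \<le> K * (\<Sum>k\<in>A. prob (E k) + \<rho> k)"
    and unbounded: "\<not> bounded (range \<Phi>)"
  shows "AE x in M. (\<lambda>n. (\<Sum>k=1..n. indicat_real (E k) x) - \<Phi> n)
    \<in> O(\<lambda>n. \<Phi> n powr (1/2) * ln (\<Phi> n) powr (3/2 + e))"
proof -
  define F where "F n = (\<Sum>k=1..n. prob (E k) + \<rho> k)" for n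
  have Phi_mono: "\<Phi> m \<le> \<Phi> n" if "m \<le> n" for m n
    unfolding \<Phi>_def using that by (intro sum_mono2) auto
  have Phi_nonneg: "0 \<le> \<Phi> n" for n unfolding \<Phi>_def by (intro sum_nonneg) simp
  have lim: "filterlim \<Phi> at_top sequentially"
    unfolding filterlim_at_top eventually_sequentially
  proof (rule allI, rule ccontr)
    fix b :: real
    assume no: "\<nexists>m. \<forall>n\<ge>m. b \<le> \<Phi> n"
    have "\<Phi> m \<le> b" for m using no Phi_mono by (metis linorder_le_cases order_trans)
    then have "bounded (range \<Phi>)" using Phi_nonneg by (auto simp: bounded_iff intro!: exI[of _ b])
    then show False using unbounded by simp
  qed
  have F1: "\<Phi> n \<le> F n" for n unfolding \<Phi>_def F_def using rho by (intro sum_mono) simp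
  have F2: "F n \<le> \<Phi> n + suminf \<rho>" for n
    unfolding F_def \<Phi>_def sum.distrib using rho by (intro add_left_mono sum_le_suminf) auto
  have "AE x in M. (\<lambda>n. \<Sum>k=1..n. indicat_real (E k) x - prob (E k))
    \<in> O(\<lambda>n. F n powr (1/2) * ln (F n) powr (3/2 + e))"
    unfolding F_def
  proof (rule gal_koksma_strong_law[where B="1 + suminf \<rho>" and K=K])
    show "prob (E k) + \<rho> k \<le> 1 + suminf \<rho>" for k
      using sum_le_suminf[of \<rho> "{k}"] rho by (intro add_mono) auto
    show "(\<integral>\<^sup>+x. ennreal ((\<Sum>k\<in>{m<..n}. indicat_real (E k) x - prob (E k))\<^sup>2) \<partial>M)
        \<le> ennreal (K * (\<Sum>k\<in>{m<..n}. prob (E k) + \<rho> k))" for m n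
      using E by (subst second_moment_centred_indicators) (auto intro!: ennreal_leI cov)
    show "filterlim (\<lambda>n. \<Sum>k=1..n. prob (E k) + \<rho> k) at_top sequentially"
      using filterlim_at_top_mono[OF lim, of F] F1 by (simp add: F_def)
  qed (use E K rho e in auto)
  then show ?thesis
  proof eventually_elim
    case (elim x)
    have "(\<lambda>n. F n powr (1/2) * ln (F n) powr (3/2 + e))
        \<in> O(\<lambda>n. \<Phi> n powr (1/2) * ln (\<Phi> n) powr (3/2 + e))"
      using e by (intro bigo_shift_scale[OF lim F1 F2]) auto
    from landau_o.big_trans[OF elim this] show ?case by (simp add: \<Phi>_def sum_subtractf)
  qed
qed

theorem theorem2:
  fixes M :: "'a::metric_space measure"
    and T :: "'a \<Rightarrow> 'a"
    and atlas :: "('a, 'b::euclidean_space) chart set"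
    and g :: "('a, 'b) chart \<Rightarrow> 'b \<Rightarrow> 'b \<Rightarrow> 'b \<Rightarrow> real"
    and E :: "nat \<Rightarrow> 'a set"
    and \<mu> :: "'a set \<Rightarrow> real"
    and C N \<delta> \<tau> \<sigma> :: real
    and \<Psi> :: "nat \<Rightarrow> real"
    and \<Phi> :: "nat \<Rightarrow> real"
  assumes manifold: "compact_riemannian_manifold atlas g"
    and system: "metric_mps M T"
    and mu: "\<mu> = measure (completion M)"
    and E_measurable: "\<And>k. k \<ge> 1 \<Longrightarrow> E k \<in> sets (completion M)"
    and constants: "C > 0" "N > 0" "\<delta> > 0" "\<tau> > 0" "0 < \<sigma>" "\<sigma> \<le> 1"
    and Psi_nonneg: "\<And>l. \<Psi> l \<ge> 0"
    and Psi_summable: "summable \<Psi>"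
    and measure_bound:
      "\<And>k. k \<ge> 2 \<Longrightarrow> \<mu> (E k) \<le> C / ln (real k) powr ((2 + N) / \<delta>)"
    and decorrelation:
      "\<And>k l. k \<ge> 1 \<Longrightarrow> l \<ge> 1 \<Longrightarrow>
         \<mu> (E k \<inter> E (k + l)) \<le> \<mu> (E k) * \<mu> (E (k + l))
           + C * (exp (- \<tau> * real k) + exp (- \<tau> * real l))"
    and short_returns:
      "\<And>k l. k \<ge> 1 \<Longrightarrow> l \<ge> 1 \<Longrightarrow> real l \<le> (ln (real k))\<^sup>2 \<Longrightarrow>
         \<mu> (E k \<inter> E (k + l)) \<le> C * \<mu> (E k) powr (1 + \<delta>) * ln (real k) powr N + \<mu> (E k) * \<Psi> l"
    and long_gaps:
      "\<And>k l. k \<ge> 1 \<Longrightarrow> l \<ge> 1 \<Longrightarrow> real k \<le> \<sigma> * real l \<Longrightarrow>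
         \<mu> (E k \<inter> E (k + l)) \<le> \<mu> (E k) * \<mu> (E (k + l))
           + C * \<mu> (E (k + l)) * exp (- \<tau> * real k) + C * exp (- \<tau> * real l)"
    and Phi: "\<And>n. \<Phi> n = (\<Sum>k=1..n. \<mu> (E k))"
  shows "\<forall>\<epsilon>>0. AE x in M.
    (if bounded (range \<Phi>)
     then bounded (range (\<lambda>n. (\<Sum>k=1..n. indicat_real (E k) x) - \<Phi> n))
     else (\<lambda>n. (\<Sum>k=1..n. indicat_real (E k) x) - \<Phi> n)
            \<in> O(\<lambda>n. \<Phi> n powr (1/2) * ln (\<Phi> n) powr (3/2 + \<epsilon>)))"
proof (intro allI impI)
  fix \<epsilon> :: real assume \<epsilon>: "0 < \<epsilon>"
  interpret M: metric_mps M T by (rule system)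
  \<comment> \<open>The sets \<open>E k\<close> are measurable only for the completion; almost everywhere means the same for both.\<close>
  interpret P: prob_space "completion M" by (rule M.prob_space_completion)
  have Phi': "\<Phi> = (\<lambda>n. \<Sum>k=1..n. P.prob (E k))" using Phi mu by auto
  show "AE x in M.
    (if bounded (range \<Phi>)
     then bounded (range (\<lambda>n. (\<Sum>k=1..n. indicat_real (E k) x) - \<Phi> n))
     else (\<lambda>n. (\<Sum>k=1..n. indicat_real (E k) x) - \<Phi> n)
            \<in> O(\<lambda>n. \<Phi> n powr (1/2) * ln (\<Phi> n) powr (3/2 + \<epsilon>)))"
  proof (cases "bounded (range \<Phi>)")
    case True
    then show ?thesis
      using P.bounded_count_deviation[of E] E_measurable
      unfolding Phi' AE_completion_iff by simp
  next
    case False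
    obtain K \<rho> where K: "0 \<le> K" "\<And>k. 0 \<le> \<rho> k" "summable \<rho>"
      "\<And>A. finite A \<Longrightarrow> A \<subseteq> {1..} \<Longrightarrow>
        (\<Sum>k\<in>A. \<Sum>l\<in>A. \<mu> (E k \<inter> E l) - \<mu> (E k) * \<mu> (E l)) \<le> K * (\<Sum>k\<in>A. \<mu> (E k) + \<rho> k)"
    proof (rule covariance_sum_bound[where a = "\<lambda>k. \<mu> (E k)" and p = "\<lambda>k l. \<mu> (E k \<inter> E l)"
          and C=C and N=N and \<delta>=\<delta> and \<tau>=\<tau> and \<sigma>=\<sigma> and \<Psi>=\<Psi>])
      show "\<mu> (E k \<inter> E l) = \<mu> (E l \<inter> E k)" for k l by (simp add: Int_commute)
    qed (use constants Psi_nonneg Psi_summable measure_bound decorrelation short_returns long_gaps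
        in \<open>auto simp: mu\<close>)
    have "AE x in completion M. (\<lambda>n. (\<Sum>k=1..n. indicat_real (E k) x) - (\<Sum>k=1..n. P.prob (E k)))
      \<in> O(\<lambda>n. (\<Sum>k=1..n. P.prob (E k)) powr (1/2) * ln (\<Sum>k=1..n. P.prob (E k)) powr (3/2 + \<epsilon>))"
      using K False \<epsilon> E_measurable unfolding Phi' mu
      by (intro P.count_deviation_of_covariance_bound) auto
    then show ?thesis using False unfolding Phi' AE_completion_iff by simp
  qed
qed

end
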